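(* Let $n\ge 1$ and let $V\colon\mathbb{R}\times\mathbb{R}^n\to\mathbb{R}$ be of the form $V(t,q)=-K(t,q)+W(t,q)$, where $K,W\colon\mathbb{R}\times\mathbb{R}^n\to\mathbb{R}$ are $C^1$-smooth and satisfy: (C1) the maps $\nabla_q K$ and $\nabla_q W$ are uniformly bounded in the time variable $t\in\mathbb{R}$ on every compact subset of $\mathbb{R}^n$; (C2) there exist two positive constants $b_1,b_2$ such that $b_1|q|^2\le K(t,q)\le b_2|q|^2$ for all $t\in\mathbb{R}$ and $q\in\mathbb{R}^n$; (C3) $K(t,q)\le (q,\nabla_q K(t,q))\le 2K(t,q)$ for all $t\in\mathbb{R}$ and $q\in\mathbb{R}^n$; (C4) $\nabla_q W(t,q)=o(|q|)$ as $|q|\to 0$ uniformly in $t\in\mathbb{R}$; (C5) there is a constant $\mu>2$ such that $0<\mu W(t,q)\le (q,\nabla_q W(t,q))$ for all $t\in\mathbb{R}$ and $q\in\mathbb{R}^n\setminus\{0\}$; (C6) $m:=\inf\{W(t,q)\colon t\in\mathbb{R},\ |q|=1\}>0$. Set $M:=\sup\{W(t,q)\colon t\in\mathbb{R},\ |q|=1\}$ and $\bar b_1:=\min\{1,2b_1\}$, and assume that $M<\frac12\bar b_1$. If $f\colon\mathbb{R}\to\mathbb{R}^n$ is continuous, bounded, and $$\left(\int_{-\infty}^{\infty}|f(t)|^2\,dt\right)^{1/2}<\frac{\sqrt2}{4}\left(\bar b_1-2M\right),$$ then the system $$\ddot q(t)+\nabla_q V(t,q(t))=f(t)\quad (t\in\mathbb{R}),\qquad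 \lim_{t\to\pm\infty}q(t)=\lim_{t\to\pm\infty}\dot q(t)=0,$$ possesses at least one solution $q\colon\mathbb{R}\to\mathbb{R}^n$.
   Context: $(\cdot,\cdot)$ is the standard inner product on $\mathbb{R}^n$ and $|\cdot|$ its induced norm; $\nabla_q$ denotes the gradient with respect to the variable $q$. A map $F\colon\mathbb{R}\times\mathbb{R}^n\to\mathbb{R}^n$ is uniformly bounded in $t$ on every compact subset of $\mathbb{R}^n$ if for every $L>0$ there is $C>0$ such that $|F(t,q)|\le C$ for all $t\in\mathbb{R}$ and all $q\in\mathbb{R}^n$ with $|q|\le L$. A solution is a classical ($C^2$) function satisfying the differential equation for all $t\in\mathbb{R}$ together with the stated limits. The constant $b_1$ in $\bar b_1$ is the one from (C2). *)

theory Defs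
  imports "HOL-Analysis.Analysis"
begin

definition C1_smooth :: "('a::real_normed_vector \<Rightarrow> 'b::real_normed_vector) \<Rightarrow> bool" where
  "C1_smooth F \<longleftrightarrow>
     (\<exists>F' :: 'a \<Rightarrow> 'a \<Rightarrow>\<^sub>L 'b.
        (\<forall>x. (F has_derivative blinfun_apply (F' x)) (at x)) \<and> continuous_on UNIV F')"

text \<open>The value is unspecified where \<open>F (t, \<cdot>)\<close> is not differentiable at \<open>q\<close>;
  for \<open>C1_smooth F\<close> this does not occur.\<close>

definition grad_q :: "(real \<times> (real ^ 'n::finite) \<Rightarrow> real) \<Rightarrow> real \<times> (real ^ 'n) \<Rightarrow> real ^ 'n" where
  "grad_q F = (\<lambda>(t, q). THE D. GDERIV (\<lambda>x. F (t, x)) q :> D)"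

definition unif_bounded_in_time :: "(real \<times> (real ^ 'n::finite) \<Rightarrow> real ^ 'n) \<Rightarrow> bool" where
  "unif_bounded_in_time F \<longleftrightarrow>
     (\<forall>L>0. \<exists>C>0. \<forall>t q. norm q \<le> L \<longrightarrow> norm (F (t, q)) \<le> C)"

definition solution ::
  "(real \<times> (real ^ 'n::finite) \<Rightarrow> real) \<Rightarrow> (real \<Rightarrow> real ^ 'n) \<Rightarrow> (real \<Rightarrow> real ^ 'n) \<Rightarrow> bool" where
  "solution V f q \<longleftrightarrow>
     (\<exists>dq ddq.
        (\<forall>t. (q has_vector_derivative dq t) (at t)) \<and>
        (\<forall>t. (dq has_vector_derivative ddq t) (at t)) \<and>
        continuous_on UNIV ddq \<and>
        (\<forall>t. ddq t + grad_q V (t, q t) = f t) \<and>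
        (q \<longlongrightarrow> 0) at_top \<and> (q \<longlongrightarrow> 0) at_bot \<and>
        (dq \<longlongrightarrow> 0) at_top \<and> (dq \<longlongrightarrow> 0) at_bot)"

end

theory Submission
  imports Defs
begin

text \<open>
  The solution is a local minimiser of the action
  \[ I(q) = \int \tfrac12 |\dot q|^2 + K(t,q) - W(t,q) + (f,q) \, dt \]
  in the ball of squared \<open>H\<^sup>1\<close>-norm at most \<open>1/2\<close>. The radius is chosen because
  \<open>|q|\<^sup>2 \<le> 2 \<parallel>q\<parallel>\<^sup>2\<close> pointwise, so paths in this ball stay in the unit ball.
  There the superquadratic growth of \<open>W\<close> along rays gives \<open>W(t,q) \<le> M |q|\<^sup>2\<close>, hence
  \<open>I(q) \<ge> c \<parallel>q\<parallel>\<^sup>2 - \<parallel>f\<parallel> \<parallel>q\<parallel>\<close> with \<open>c = b1bar/2 - M > 0\<close>. The smallness assumption on \<open>f\<close> says exactly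
  \<open>\<parallel>f\<parallel> < c / \<surd>2\<close>, so \<open>I > 0 = I(0)\<close> on the boundary sphere and a minimiser lies in the interior,
  where it satisfies the Euler-Lagrange equation.

  On the whole line the term with \<open>W\<close> need not be weakly lower semicontinuous, so \<open>I\<close> is not minimised
  directly. Instead, its finite difference analogues are minimised under zero boundary values
  on the grids of step \<open>1/(k+1)\<close> in \<open>[-(k+1), k+1]\<close> (\<open>discrete_minimiser\<close>). There the problem is
  finite-dimensional, and the constants are the same as in the continuous one. The discrete
  Euler-Lagrange equation bounds second differences, and therefore first differences, independently of \<open>k\<close>.

  By Tychonoff's theorem the grid paths, their difference quotients and their partial energies
  converge pointwise at every real time along some filter finer than \<open>sequentially\<close>
  (\<open>pointwise_limit_along_subfilter\<close>). The uniform bounds make difference quotients near a given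
  time uniformly close to the limiting slope, which turns the discrete equation into the differential
  equation (\<open>grid_limit_has_vector_derivative\<close>). The limit of the partial energies is monotone and
  bounded, so its increments over intervals of fixed length vanish at infinity; together with the
  Lipschitz bounds this forces \<open>q\<close> and its derivative to \<open>0\<close> (\<open>tendsto_0_if_energy_finite\<close>).
\<close>

section \<open>Pointwise limits of bounded families\<close>

lemma compact_fun_cball:
  fixes B :: "'i \<Rightarrow> real"
  shows "compact {x :: 'i \<Rightarrow> 'a::euclidean_space. \<forall>i. norm (x i) \<le> B i}"
proof -
  have "compactin (product_topology (\<lambda>i::'i. euclidean :: 'a topology) UNIV) (PiE UNIV (\<lambda>i. cball 0 (B i)))"
    unfolding compactin_PiE by simp
  moreover have "PiE UNIV (\<lambda>i. cball (0::'a) (B i)) = {x. \<forall>i. norm (x i) \<le> B i}"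
    by (auto simp: PiE_def Pi_def)
  ultimately show ?thesis
    by (simp add: euclidean_product_topology)
qed

text \<open>Pointwise boundedness alone yields limits at all indices simultaneously, even for an uncountable
  index type such as \<^typ>\<open>real\<close>. There the product space is not metrisable and a convergent
  subsequence need not exist, so a cluster point is described by a filter instead.\<close>
lemma pointwise_limit_along_subfilter:
  fixes z :: "nat \<Rightarrow> 'i \<Rightarrow> 'a::euclidean_space"
  assumes "\<And>i. Bseq (\<lambda>k. z k i)"
  obtains G x where "G \<le> sequentially" "G \<noteq> bot" "\<And>i. ((\<lambda>k. z k i) \<longlongrightarrow> x i) G"
proof -
  have "\<forall>i. \<exists>B. \<forall>k. norm (z k i) \<le> B"
    using assms unfolding Bseq_def by blast
  then obtain B where B: "\<And>i k. norm (z k i) \<le> B i"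
    by metis
  let ?C = "{x. \<forall>i. norm (x i) \<le> B i}"
  have ne: "filtermap z sequentially \<noteq> bot"
    by (simp add: filtermap_bot_iff)
  have "eventually (\<lambda>x. x \<in> ?C) (filtermap z sequentially)"
    using B by (simp add: eventually_filtermap)
  with compact_fun_cball[of B] ne obtain x where x: "inf (nhds x) (filtermap z sequentially) \<noteq> bot"
    unfolding compact_filter by blast
  define G where "G = inf (filtercomap z (nhds x)) sequentially"
  have "G \<noteq> bot"
  proof
    assume "G = bot"
    then have "eventually (\<lambda>_. False) (inf (filtercomap z (nhds x)) sequentially)"
      by (simp add: G_def)
    then obtain P Q where "eventually P (filtercomap z (nhds x))" "eventually Q sequentially"
      "\<And>k. P k \<Longrightarrow> Q k \<Longrightarrow> False"
      by (auto simp: eventually_inf)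
    moreover from this obtain R where "eventually R (nhds x)" "\<And>k. R (z k) \<Longrightarrow> P k"
      by (auto simp: eventually_filtercomap)
    ultimately have "eventually R (nhds x)" "eventually (\<lambda>y. \<not> R y) (filtermap z sequentially)"
      unfolding eventually_filtermap by (blast, blast intro: eventually_mono)
    then have "eventually (\<lambda>_. False) (inf (nhds x) (filtermap z sequentially))"
      by (auto simp: eventually_inf)
    with x show False
      by (simp add: trivial_limit_def)
  qed
  moreover have "G \<le> sequentially" by (simp add: G_def)
  moreover have "((\<lambda>k. z k i) \<longlongrightarrow> x i) G" for i
  proof -
    have "(z \<longlongrightarrow> x) G"
      unfolding G_def filterlim_def
      by (meson filtermap_filtercomap filtermap_mono inf_le1 order_trans)
    then show ?thesis
      by (rule continuous_on_tendsto_compose[OF continuous_on_product_coordinates[of i]]) auto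
  qed
  ultimately show ?thesis using that by blast
qed

section \<open>The discrete variational problem\<close>
definition step_quot :: "real \<Rightarrow> (nat \<Rightarrow> 'a::real_vector) \<Rightarrow> nat \<Rightarrow> 'a" where
  "step_quot h q i = (q (Suc i) - q i) /\<^sub>R h"

text \<open>The finite difference analogue of the squared \<open>H\<^sup>1\<close>-norm.\<close>
definition energy :: "real \<Rightarrow> nat \<Rightarrow> (nat \<Rightarrow> 'a::real_normed_vector) \<Rightarrow> real" where
  "energy h n q = (\<Sum>i<n. h * ((norm (step_quot h q i))\<^sup>2 + (norm (q i))\<^sup>2))"

text \<open>The functional whose critical points satisfy the finite difference version of
  \<open>q'' = \<nabla> U(t, q) + F(t)\<close>.\<close>
definition action ::
  "real \<Rightarrow> nat \<Rightarrow> (nat \<Rightarrow> 'a::real_inner \<Rightarrow> real) \<Rightarrow> (nat \<Rightarrow> 'a) \<Rightarrow> (nat \<Rightarrow> 'a) \<Rightarrow> real" where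
  "action h n U F q =
     (\<Sum>i<n. h * ((norm (step_quot h q i))\<^sup>2 / 2 + U i (q i) + F i \<bullet> q i))"

definition grid_paths :: "nat \<Rightarrow> (nat \<Rightarrow> 'a::zero) set" where
  "grid_paths n = {q. q 0 = 0 \<and> (\<forall>i\<ge>n. q i = 0)}"

text \<open>The embedding of \<open>H\<^sup>1\<close> into bounded functions: \<open>|q|\<^sup>2\<close> at a grid point is the sum of its
  increments from the left end, and each increment \<open>h (d, q(j+1) + q(j))\<close> is controlled by
  Young's inequality. The constant is the same for all step sizes.\<close>
lemma norm_le_energy:
  fixes q :: "nat \<Rightarrow> 'a::real_inner"
  assumes "h > 0" "q \<in> grid_paths n"
  shows "(norm (q i))\<^sup>2 \<le> 2 * energy h n q"
proof -
  have q0: "q 0 = 0" and qn: "\<And>i. i \<ge> n \<Longrightarrow> q i = 0" using assms by (auto simp: grid_paths_def)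
  define e where "e j = h * ((norm (step_quot h q j))\<^sup>2 / 2 + (norm (q (Suc j)))\<^sup>2 + (norm (q j))\<^sup>2)" for j
  have e0: "e j \<ge> 0" for j using \<open>h > 0\<close> by (simp add: e_def)
  have inc: "(norm (q (Suc j)))\<^sup>2 - (norm (q j))\<^sup>2 \<le> e j" for j
  proof -
    define d where "d = step_quot h q j"
    have s: "q (Suc j) = q j + h *\<^sub>R d" using \<open>h > 0\<close> by (simp add: d_def step_quot_def)
    have "(norm (q (Suc j)))\<^sup>2 - (norm (q j))\<^sup>2 = h * (d \<bullet> (q (Suc j) + q j))"
      by (simp add: s power2_norm_eq_inner inner_commute algebra_simps)
    moreover have "d \<bullet> (q (Suc j) + q j) \<le> (norm d)\<^sup>2 / 2 + (norm (q (Suc j) + q j))\<^sup>2 / 2"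
    proof -
      have "0 \<le> (norm (d - (q (Suc j) + q j)))\<^sup>2" by simp
      then show ?thesis
        by (simp add: power2_norm_eq_inner inner_diff_left inner_diff_right inner_commute)
    qed
    moreover have "(norm (q (Suc j) + q j))\<^sup>2 \<le> 2 * (norm (q (Suc j)))\<^sup>2 + 2 * (norm (q j))\<^sup>2"
    proof -
      have "0 \<le> (norm (q (Suc j) - q j))\<^sup>2" by simp
      then show ?thesis by (simp add: power2_norm_eq_inner inner_commute algebra_simps)
    qed
    ultimately show ?thesis
      unfolding e_def d_def[symmetric] using \<open>h > 0\<close> by (auto intro!: mult_left_mono)
  qed
  show ?thesis
  proof (cases "i < n")
    case False
    then show ?thesis using qn[of i] \<open>h > 0\<close> by (simp add: energy_def sum_nonneg)
  next
    case True
    have "(norm (q i))\<^sup>2 = (\<Sum>j<i. (norm (q (Suc j)))\<^sup>2 - (norm (q j))\<^sup>2)"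
      using sum_lessThan_telescope[of "\<lambda>j. (norm (q j))\<^sup>2" i] by (simp add: q0)
    also have "\<dots> \<le> (\<Sum>j<i. e j)" by (intro sum_mono inc)
    also have "\<dots> \<le> (\<Sum>j<n. e j)" using True e0 by (intro sum_mono2) auto
    also have "\<dots> = (\<Sum>j<n. h * ((norm (step_quot h q j))\<^sup>2 / 2 + 2 * (norm (q j))\<^sup>2))
                  + h * (\<Sum>j<n. (norm (q (Suc j)))\<^sup>2 - (norm (q j))\<^sup>2)"
      by (simp add: e_def sum_distrib_left sum.distrib[symmetric] algebra_simps)
    also have "(\<Sum>j<n. (norm (q (Suc j)))\<^sup>2 - (norm (q j))\<^sup>2) = 0"
      using sum_lessThan_telescope[of "\<lambda>j. (norm (q j))\<^sup>2" n] by (simp add: q0 qn)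
    also have "(\<Sum>j<n. h * ((norm (step_quot h q j))\<^sup>2 / 2 + 2 * (norm (q j))\<^sup>2)) \<le> 2 * energy h n q"
      unfolding energy_def sum_distrib_left
      using \<open>h > 0\<close> by (intro sum_mono) (simp add: algebra_simps)
    finally show ?thesis by simp
  qed
qed

lemma norm_le_1_if_energy_le_half:
  fixes q :: "nat \<Rightarrow> 'a::real_inner"
  assumes "h > 0" "q \<in> grid_paths n" "energy h n q \<le> 1 / 2"
  shows "norm (q i) \<le> 1"
proof -
  have "(norm (q i))\<^sup>2 \<le> 1\<^sup>2" using norm_le_energy[OF assms(1,2), of i] assms(3) by simp
  then show ?thesis by (rule power2_le_imp_le) simp
qed

lemma sum_weighted_inner_ge:
  fixes F q :: "nat \<Rightarrow> 'a::real_inner"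
  assumes "h \<ge> 0" "(\<Sum>i<n. h * (norm (F i))\<^sup>2) \<le> a\<^sup>2" "(\<Sum>i<n. h * (norm (q i))\<^sup>2) \<le> b\<^sup>2"
    "a \<ge> 0" "b \<ge> 0"
  shows "(\<Sum>i<n. h * (F i \<bullet> q i)) \<ge> - (a * b)"
proof -
  have "- (\<Sum>i<n. h * (F i \<bullet> q i)) \<le> (\<Sum>i<n. \<bar>sqrt h * norm (F i)\<bar> * \<bar>sqrt h * norm (q i)\<bar>)"
    unfolding sum_negf[symmetric]
  proof (intro sum_mono)
    fix i
    have "- (F i \<bullet> q i) \<le> norm (F i) * norm (q i)"
      using Cauchy_Schwarz_ineq2[of "F i" "q i"] by linarith
    from mult_left_mono[OF this \<open>h \<ge> 0\<close>]
    show "- (h * (F i \<bullet> q i)) \<le> \<bar>sqrt h * norm (F i)\<bar> * \<bar>sqrt h * norm (q i)\<bar>"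
      using \<open>h \<ge> 0\<close> by (simp add: abs_mult algebra_simps)
        (metis mult.assoc real_sqrt_mult_self abs_of_nonneg)
  qed
  also have "\<dots> \<le> L2_set (\<lambda>i. sqrt h * norm (F i)) {..<n} * L2_set (\<lambda>i. sqrt h * norm (q i)) {..<n}"
    by (rule L2_set_mult_ineq)
  also have "\<dots> \<le> a * b"
    using assms by (intro mult_mono) (auto simp: L2_set_def power_mult_distrib real_le_lsqrt sum_nonneg)
  finally show ?thesis by linarith
qed

text \<open>Inside the energy ball the path stays where the lower bound on \<open>U\<close> is valid, and by
  Cauchy-Schwarz the forcing contributes at least \<open>-\<phi>\<close> times the norm.\<close>
lemma action_ge:
  fixes q :: "nat \<Rightarrow> 'a::real_inner"
  assumes "h > 0" "q \<in> grid_paths n" "energy h n q \<le> 1 / 2" "c \<le> 1 / 2" "\<phi> \<ge> 0"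
    and U: "\<And>i x. norm x \<le> 1 \<Longrightarrow> c * (norm x)\<^sup>2 \<le> U i x"
    and F: "(\<Sum>i<n. h * (norm (F i))\<^sup>2) \<le> \<phi>\<^sup>2"
  shows "action h n U F q \<ge> c * energy h n q - \<phi> * sqrt (energy h n q)"
proof -
  have E0: "energy h n q \<ge> 0" using \<open>h > 0\<close> by (simp add: energy_def sum_nonneg)
  have small: "norm (q i) \<le> 1" for i
    using assms(1-3) by (rule norm_le_1_if_energy_le_half)
  have "(\<Sum>i<n. h * (norm (q i))\<^sup>2) \<le> (sqrt (energy h n q))\<^sup>2"
    unfolding real_sqrt_pow2[OF E0] unfolding energy_def using \<open>h > 0\<close> by (intro sum_mono) simp
  with F assms E0 have *: "(\<Sum>i<n. h * (F i \<bullet> q i)) \<ge> - (\<phi> * sqrt (energy h n q))"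
    by (intro sum_weighted_inner_ge) auto
  have "c * energy h n q \<le> (\<Sum>i<n. h * ((norm (step_quot h q i))\<^sup>2 / 2 + U i (q i)))"
    unfolding energy_def sum_distrib_left
  proof (intro sum_mono)
    fix i
    have "c * (norm (step_quot h q i))\<^sup>2 \<le> 1 / 2 * (norm (step_quot h q i))\<^sup>2"
      using \<open>c \<le> 1 / 2\<close> by (intro mult_right_mono) auto
    with U[OF small[of i], of i]
    have "c * ((norm (step_quot h q i))\<^sup>2 + (norm (q i))\<^sup>2) \<le> (norm (step_quot h q i))\<^sup>2 / 2 + U i (q i)"
      unfolding distrib_left by linarith
    from mult_left_mono[OF this, of h] \<open>h > 0\<close>
    show "c * (h * ((norm (step_quot h q i))\<^sup>2 + (norm (q i))\<^sup>2))
        \<le> h * ((norm (step_quot h q i))\<^sup>2 / 2 + U i (q i))"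
      by (simp add: algebra_simps)
  qed
  with * show ?thesis
    by (simp add: action_def distrib_left sum.distrib)
qed

lemma action_has_derivative_along:
  fixes q w :: "nat \<Rightarrow> 'a::real_inner"
  assumes "h > 0" and U: "\<And>i x. GDERIV (U i) x :> g i x"
  shows "((\<lambda>s. action h n U F (\<lambda>i. q i + s *\<^sub>R w i)) has_real_derivative
     (\<Sum>i<n. h * (step_quot h q i \<bullet> step_quot h w i + (g i (q i) + F i) \<bullet> w i))) (at 0)"
proof -
  have *: "((\<lambda>s. h * ((norm (step_quot h (\<lambda>i. q i + s *\<^sub>R w i) i))\<^sup>2 / 2 + U i (q i + s *\<^sub>R w i)
            + F i \<bullet> (q i + s *\<^sub>R w i))) has_real_derivative
       h * (step_quot h q i \<bullet> step_quot h w i + (g i (q i) + F i) \<bullet> w i)) (at 0)" for i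
  proof -
    have 1: "step_quot h (\<lambda>i. q i + s *\<^sub>R w i) i = step_quot h q i + s *\<^sub>R step_quot h w i" for s
      by (simp add: step_quot_def algebra_simps)
    have U': "(U i has_derivative (\<lambda>v. v \<bullet> g i (q i))) (at (q i + 0 *\<^sub>R w i))"
      using U[of i "q i"] by (simp add: gderiv_def)
    have "((\<lambda>s. q i + s *\<^sub>R w i) has_derivative (\<lambda>s. s *\<^sub>R w i)) (at (0::real))"
      by (auto intro!: derivative_eq_intros)
    from has_derivative_compose[OF this U']
    have 2: "((\<lambda>s. U i (q i + s *\<^sub>R w i)) has_real_derivative g i (q i) \<bullet> w i) (at 0)"
      unfolding has_field_derivative_def
      by (rule has_derivative_eq_rhs) (simp add: fun_eq_iff inner_commute)
    show ?thesis
      unfolding 1 power2_norm_eq_inner inner_add_left inner_add_right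
      by (rule derivative_eq_intros 2 refl | simp add: inner_commute algebra_simps)+
  qed
  show ?thesis
    unfolding action_def by (intro DERIV_sum *)
qed

text \<open>Below the threshold \<open>c / \<surd>2\<close> the action is positive on the sphere of energy \<open>1/2\<close>. Since it vanishes
  at the zero path, a minimiser over the ball lies in the interior and each interior grid value may be
  varied freely.\<close>
lemma discrete_minimiser:
  fixes U :: "nat \<Rightarrow> 'a::euclidean_space \<Rightarrow> real"
  assumes "h > 0" "c > 0" "c \<le> 1 / 2" "\<phi> \<ge> 0" "\<phi> < c / sqrt 2"
    and U: "\<And>i x. GDERIV (U i) x :> g i x" "\<And>i. U i 0 = 0"
      "\<And>i x. norm x \<le> 1 \<Longrightarrow> c * (norm x)\<^sup>2 \<le> U i x"
    and F: "(\<Sum>i<n. h * (norm (F i))\<^sup>2) \<le> \<phi>\<^sup>2"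
  obtains q where "q \<in> grid_paths n" "energy h n q \<le> 1 / 2"
    "\<And>i. Suc i < n \<Longrightarrow>
       step_quot h q (Suc i) - step_quot h q i = h *\<^sub>R (g (Suc i) (q (Suc i)) + F (Suc i))"
proof -
  define S where "S = {q :: nat \<Rightarrow> 'a. q \<in> grid_paths n \<and> energy h n q \<le> 1 / 2}"
  have contU: "continuous_on UNIV (U i)" for i
    using U(1)[of i] unfolding gderiv_def continuous_on_eq_continuous_within
    by (blast intro: has_derivative_continuous)
  have contE: "continuous_on UNIV (energy h n :: (nat \<Rightarrow> 'a) \<Rightarrow> real)"
    unfolding energy_def step_quot_def by (intro continuous_intros continuous_on_product_coordinates)
  have contA: "continuous_on UNIV (action h n U F)"
    unfolding action_def step_quot_def
    by (intro continuous_intros continuous_on_product_coordinates continuous_on_compose2[OF contU]) auto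
  have "closed (grid_paths n :: (nat \<Rightarrow> 'a) set)"
    unfolding grid_paths_def
    by (intro closed_Collect_conj closed_Collect_all closed_Collect_imp closed_Collect_eq
        continuous_on_product_coordinates continuous_on_const open_Collect_const)
  moreover have "closed {q :: nat \<Rightarrow> 'a. energy h n q \<le> 1 / 2}"
    by (intro closed_Collect_le contE continuous_on_const)
  ultimately have "closed S"
    unfolding S_def by (simp add: closed_Collect_conj)
  moreover have "S \<subseteq> {q. \<forall>i. norm (q i) \<le> 1}"
    using norm_le_1_if_energy_le_half[OF \<open>h > 0\<close>] by (auto simp: S_def)
  ultimately have "compact S"
    using compact_Int_closed[OF compact_fun_cball, of S "\<lambda>_. 1"] by (simp add: Int_absorb1)
  have zero: "(\<lambda>_. 0) \<in> S" by (simp add: S_def grid_paths_def energy_def step_quot_def)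
  obtain q where q: "q \<in> S" and min: "\<And>p. p \<in> S \<Longrightarrow> action h n U F q \<le> action h n U F p"
    using continuous_attains_inf[OF \<open>compact S\<close> _ continuous_on_subset[OF contA]] zero by blast
  have "energy h n q \<noteq> 1 / 2"
  proof
    assume E: "energy h n q = 1 / 2"
    have "action h n U F q \<ge> c * (1 / 2) - \<phi> * sqrt (1 / 2)"
      using action_ge[of h q n c \<phi> U F] q assms E by (simp add: S_def)
    moreover have "\<phi> * sqrt (1 / 2) < c * (1 / 2)"
    proof -
      have "\<phi> * sqrt (1 / 2) < c / sqrt 2 * sqrt (1 / 2)"
        using \<open>\<phi> < c / sqrt 2\<close> by (intro mult_strict_right_mono) auto
      also have "\<dots> = c * (1 / 2)" by (simp add: real_sqrt_divide)
      finally show ?thesis .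
    qed
    moreover have "action h n U F (\<lambda>_. 0) = 0" by (simp add: action_def step_quot_def U(2))
    ultimately show False using min[OF zero] by linarith
  qed
  then have E: "energy h n q < 1 / 2" using q by (simp add: S_def)
  have "step_quot h q (Suc i) - step_quot h q i = h *\<^sub>R (g (Suc i) (q (Suc i)) + F (Suc i))"
    if "Suc i < n" for i
  proof -
    \<comment> \<open>Varying the value at this node in the direction of the residual \<open>r\<close> yields \<open>(r, r) = 0\<close>.\<close>
    define r where "r = step_quot h q i - step_quot h q (Suc i) + h *\<^sub>R (g (Suc i) (q (Suc i)) + F (Suc i))"
    define w where "w j = (if j = Suc i then r else 0)" for j
    let ?p = "\<lambda>s::real. \<lambda>j. q j + s *\<^sub>R w j"
    have "isCont (\<lambda>s. energy h n (?p s)) 0"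
      unfolding energy_def step_quot_def by (intro continuous_intros)
    then have "eventually (\<lambda>s. energy h n (?p s) < 1 / 2) (at 0)"
      unfolding isCont_def using E by (intro order_tendstoD(2)) auto
    then obtain e where e: "e > 0" "\<And>s. s \<noteq> 0 \<Longrightarrow> \<bar>s\<bar> < e \<Longrightarrow> energy h n (?p s) < 1 / 2"
      by (auto simp: eventually_at)
    have "?p s \<in> S" if "\<bar>s\<bar> < e" for s
      using e(2)[OF _ that] q \<open>Suc i < n\<close> by (cases "s = 0") (auto simp: S_def grid_paths_def w_def)
    then have loc: "\<forall>s. \<bar>0 - s\<bar> < e \<longrightarrow> action h n U F (?p 0) \<le> action h n U F (?p s)"
      using min by simp
    have "(\<Sum>j<n. h * (step_quot h q j \<bullet> step_quot h w j + (g j (q j) + F j) \<bullet> w j)) = 0"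
      by (rule DERIV_local_min[OF action_has_derivative_along[OF \<open>h > 0\<close> U(1)] e(1) loc])
    also have "(\<Sum>j<n. h * (step_quot h q j \<bullet> step_quot h w j + (g j (q j) + F j) \<bullet> w j))
       = (\<Sum>j\<in>{i, Suc i}. h * (step_quot h q j \<bullet> step_quot h w j + (g j (q j) + F j) \<bullet> w j))"
      using that by (intro sum.mono_neutral_right) (auto simp: w_def step_quot_def)
    also have "\<dots> = (step_quot h q i - step_quot h q (Suc i)
        + h *\<^sub>R (g (Suc i) (q (Suc i)) + F (Suc i))) \<bullet> r"
      using \<open>h > 0\<close> by (simp add: w_def step_quot_def[of h w] inner_diff_left inner_add_left field_simps)
    also have "\<dots> = r \<bullet> r" by (simp add: r_def)
    finally have "r = 0" by simp
    then show ?thesis by (simp add: r_def algebra_simps)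
  qed
  with q show ?thesis by (intro that[of q]) (auto simp: S_def)
qed

section \<open>Uniform grids and the passage to the limit\<close>

text \<open>The grid number \<open>k\<close> covers \<open>[-(k+1), k+1]\<close> with step \<open>1/(k+1)\<close>, so that \<open>k+1\<close> steps make up one unit
  of time. Nodes are numbered from the left end, and \<open>cell k t\<close> is the last node not after \<open>t\<close>; it
  serves its purpose for \<open>t \<ge> -(k+1)\<close>, which holds eventually for each \<open>t\<close>.\<close>
definition mesh :: "nat \<Rightarrow> real" where "mesh k = 1 / real (Suc k)"
definition node :: "nat \<Rightarrow> nat \<Rightarrow> real" where "node k i = real i * mesh k - real (Suc k)"
definition cell :: "nat \<Rightarrow> real \<Rightarrow> nat" where "cell k t = nat \<lfloor>(t + real (Suc k)) * real (Suc k)\<rfloor>"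

lemma mesh_pos: "mesh k > 0" by (simp add: mesh_def)

lemma mesh_tendsto_0: "mesh \<longlonglongrightarrow> 0"
  unfolding mesh_def by (rule LIMSEQ_Suc) (rule lim_1_over_n)

lemma node_Suc: "node k (Suc i) = node k i + mesh k" by (simp add: node_def algebra_simps)

lemma node_diff: "i \<le> j \<Longrightarrow> node k j - node k i = real (j - i) * mesh k"
  by (simp add: node_def of_nat_diff algebra_simps)

lemma node_mono: "i \<le> j \<Longrightarrow> node k i \<le> node k j"
  using mesh_pos[of k] by (simp add: node_def mult_right_mono)

lemma node_cell:
  assumes "- real (Suc k) \<le> t"
  shows "node k (cell k t) \<le> t" "t < node k (cell k t) + mesh k"
proof -
  define x where "x = (t + real (Suc k)) * real (Suc k)"
  have "x \<ge> 0" using assms by (simp add: x_def)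
  then have c: "real (cell k t) \<le> x" "x < real (cell k t) + 1"
    unfolding cell_def x_def[symmetric] by linarith+
  have t: "t = x * mesh k - real (Suc k)" by (simp add: x_def mesh_def)
  show "node k (cell k t) \<le> t"
    using mult_right_mono[OF c(1), of "mesh k"] mesh_pos[of k] t unfolding node_def by linarith
  show "t < node k (cell k t) + mesh k"
    using mult_strict_right_mono[OF c(2) mesh_pos[of k]] t unfolding node_def distrib_right by linarith
qed

lemma cell_mono: "s \<le> t \<Longrightarrow> cell k s \<le> cell k t"
  unfolding cell_def by (intro nat_mono floor_mono mult_right_mono) auto

lemma eventually_sequentially_real_ge: "eventually (\<lambda>k. c < real k) sequentially"
  by (metis eventually_at_top_dense filterlim_at_top_dense filterlim_real_sequentially)

lemma eventually_node_cell:
  assumes "G \<le> sequentially"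
  shows "eventually (\<lambda>k. node k (cell k t) \<le> t \<and> t < node k (cell k t) + mesh k) G"
proof -
  have "eventually (\<lambda>k. - t < real k) G"
    using eventually_sequentially_real_ge assms by (rule filter_leD[rotated])
  then show ?thesis by eventually_elim (use node_cell in force)
qed

lemma node_cell_tendsto:
  assumes "G \<le> sequentially"
  shows "((\<lambda>k. node k (cell k t)) \<longlongrightarrow> t) G"
proof (rule tendsto_sandwich[where f = "\<lambda>k. t - mesh k" and h = "\<lambda>_. t"])
  have "(mesh \<longlongrightarrow> 0) G" using mesh_tendsto_0 assms by (rule tendsto_mono[rotated])
  then show "((\<lambda>k. t - mesh k) \<longlongrightarrow> t) G" by (auto intro!: tendsto_eq_intros)
qed (use eventually_node_cell[OF assms, of t] in \<open>auto elim!: eventually_mono\<close>)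

text \<open>A discrete mean value inequality. With \<open>z = 0\<close> it gives Lipschitz bounds.\<close>
lemma increment_close_to_slope:
  fixes y :: "nat \<Rightarrow> 'a::real_normed_vector"
  assumes "i \<le> j" and "\<And>l. i \<le> l \<Longrightarrow> l < j \<Longrightarrow> norm (step_quot (mesh k) y l - z) \<le> \<epsilon>"
  shows "norm (y j - y i - (node k j - node k i) *\<^sub>R z) \<le> \<epsilon> * (node k j - node k i)"
  using assms
proof (induction j rule: dec_induct)
  case base
  then show ?case by simp
next
  case (step j)
  have m: "mesh k > 0" by (rule mesh_pos)
  have "y (Suc j) - y i - (node k (Suc j) - node k i) *\<^sub>R z
      = (y j - y i - (node k j - node k i) *\<^sub>R z) + mesh k *\<^sub>R (step_quot (mesh k) y j - z)"
    using m by (simp add: step_quot_def node_Suc algebra_simps)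
  also have "norm \<dots> \<le> \<epsilon> * (node k j - node k i) + mesh k * \<epsilon>"
    using m step by (intro norm_triangle_mono) auto
  finally show ?case by (simp add: node_Suc algebra_simps)
qed

lemma grid_lipschitz:
  fixes y :: "nat \<Rightarrow> 'a::real_normed_vector"
  assumes "\<And>l. node k l < b \<Longrightarrow> norm (step_quot (mesh k) y l) \<le> L"
    and "node k i < b" "node k j < b"
  shows "norm (y j - y i) \<le> L * \<bar>node k j - node k i\<bar>"
proof -
  have *: "norm (y j - y i) \<le> L * \<bar>node k j - node k i\<bar>" if "i \<le> j" "node k j < b" for i j
  proof -
    have "norm (step_quot (mesh k) y l - 0) \<le> L" if "l < j" for l
      using assms(1)[of l] node_mono[of l j k] that \<open>node k j < b\<close> by simp
    from increment_close_to_slope[OF \<open>i \<le> j\<close> this] node_mono[OF \<open>i \<le> j\<close>, of k] show ?thesis by simp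
  qed
  show ?thesis
    using *[of i j] *[of j i] assms(2,3) by (cases "i \<le> j") (auto simp: norm_minus_commute abs_minus_commute)
qed

text \<open>If all difference quotients near \<open>x\<close> are eventually within \<open>\<epsilon>\<close> of \<open>z\<close>, the mean value inequality bounds
  \<open>y(t) - y(s) - (t - s) z\<close> by \<open>\<epsilon> (t - s)\<close> for all \<open>s \<le> t\<close> near \<open>x\<close>. This inequality survives pointwise limits,
  and taking \<open>s = x\<close> or \<open>t = x\<close> gives the derivative from both sides.\<close>
lemma grid_limit_has_vector_derivative:
  fixes y :: "nat \<Rightarrow> nat \<Rightarrow> 'a::real_normed_vector"
  assumes G: "G \<le> sequentially" "G \<noteq> bot"
    and lim: "\<And>t. ((\<lambda>k. y k (cell k t)) \<longlongrightarrow> Y t) G"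
    and slope: "\<And>\<epsilon>. \<epsilon> > 0 \<Longrightarrow> \<exists>\<delta>>0. eventually (\<lambda>k. \<forall>l. \<bar>node k l - x\<bar> < \<delta> \<longrightarrow>
                  norm (step_quot (mesh k) (y k) l - z) \<le> \<epsilon>) G"
  shows "(Y has_vector_derivative z) (at x)"
  unfolding has_vector_derivative_def has_derivative_at_alt
proof (intro conjI allI impI)
  show "bounded_linear (\<lambda>u. u *\<^sub>R z)" by (rule bounded_linear_scaleR_left)
  fix \<epsilon> :: real assume "\<epsilon> > 0"
  from slope[OF this] obtain \<delta> where \<delta>: "\<delta> > 0" and ev: "eventually (\<lambda>k. \<forall>l. \<bar>node k l - x\<bar> < \<delta> \<longrightarrow>
                  norm (step_quot (mesh k) (y k) l - z) \<le> \<epsilon>) G" by blast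
  have key: "norm (Y t - Y s - (t - s) *\<^sub>R z) \<le> \<epsilon> * (t - s)"
    if "s \<le> t" "\<bar>s - x\<bar> < \<delta>" "\<bar>t - x\<bar> < \<delta>" for s t
  proof (rule tendsto_le[OF G(2)])
    show "((\<lambda>k. \<epsilon> * (node k (cell k t) - node k (cell k s))) \<longlongrightarrow> \<epsilon> * (t - s)) G"
      by (intro tendsto_intros node_cell_tendsto G)
    show "((\<lambda>k. norm (y k (cell k t) - y k (cell k s) - (node k (cell k t) - node k (cell k s)) *\<^sub>R z))
        \<longlongrightarrow> norm (Y t - Y s - (t - s) *\<^sub>R z)) G"
      by (intro tendsto_intros node_cell_tendsto G lim)
    have "eventually (\<lambda>k. x - \<delta> < node k (cell k s)) G"
      using node_cell_tendsto[OF G(1), of s] that(2) by (intro order_tendstoD(1)) auto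
    then show "eventually (\<lambda>k.
        norm (y k (cell k t) - y k (cell k s) - (node k (cell k t) - node k (cell k s)) *\<^sub>R z)
        \<le> \<epsilon> * (node k (cell k t) - node k (cell k s))) G"
      using ev eventually_node_cell[OF G(1), of t]
    proof eventually_elim
      case (elim k)
      have "norm (step_quot (mesh k) (y k) l - z) \<le> \<epsilon>" if "cell k s \<le> l" "l < cell k t" for l
      proof -
        have "node k (cell k s) \<le> node k l" "node k l \<le> node k (cell k t)"
          using that by (auto intro: node_mono)
        then show ?thesis using elim \<open>\<bar>t - x\<bar> < \<delta>\<close> by auto
      qed
      then show ?case by (intro increment_close_to_slope cell_mono that)
    qed
  qed
  have "norm (Y u - Y x - (u - x) *\<^sub>R z) \<le> \<epsilon> * norm (u - x)" if "norm (u - x) < \<delta>" for u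
  proof (cases "x \<le> u")
    case True
    then show ?thesis using key[of x u] that \<delta> by simp
  next
    case False
    have "norm (Y u - Y x - (u - x) *\<^sub>R z) = norm (Y x - Y u - (x - u) *\<^sub>R z)"
      by (subst norm_minus_commute[symmetric]) (simp add: algebra_simps)
    then show ?thesis using key[of u x] that \<delta> False by simp
  qed
  then show "\<exists>d>0. \<forall>y. norm (y - x) < d \<longrightarrow> norm (Y y - Y x - (y - x) *\<^sub>R z) \<le> \<epsilon> * norm (y - x)"
    using \<delta> by blast
qed

text \<open>A Lipschitz path that is large at \<open>t\<close> stays large for a while and thus uses up a definite amount of
  energy after \<open>t\<close>. The estimate is proved on the grids, where the energy is a sum, so that
  the limit requires no interchange with an integral.\<close>
lemma grid_limit_energy_estimate:
  fixes y :: "nat \<Rightarrow> nat \<Rightarrow> 'a::real_normed_vector"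
  assumes G: "G \<le> sequentially" "G \<noteq> bot"
    and lim: "\<And>t. ((\<lambda>k. y k (cell k t)) \<longlongrightarrow> Y t) G"
    and lim_energy: "\<And>t. ((\<lambda>k. \<Sum>l<cell k t. mesh k * e k l) \<longlongrightarrow> \<Phi> t) G"
    and e: "\<And>k l. (norm (y k l))\<^sup>2 \<le> e k l"
    and lip: "\<And>k l. node k l < real k \<Longrightarrow> norm (step_quot (mesh k) (y k) l) \<le> L"
    and "L \<ge> 0" "\<delta> > 0"
  shows "\<delta> * (max 0 (norm (Y t) - L * \<delta>))\<^sup>2 \<le> \<Phi> (t + \<delta>) - \<Phi> t"
proof (rule tendsto_le[OF G(2)])
  let ?i = "\<lambda>k. cell k t" and ?j = "\<lambda>k. cell k (t + \<delta>)"
  show "((\<lambda>k. (\<Sum>l<?j k. mesh k * e k l) - (\<Sum>l<?i k. mesh k * e k l)) \<longlongrightarrow> \<Phi> (t + \<delta>) - \<Phi> t) G"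
    by (intro tendsto_intros lim_energy)
  have "((\<lambda>k. (node k (?j k) - node k (?i k)) * (max 0 (norm (y k (?i k)) - L * (node k (?j k) - node k (?i k))))\<^sup>2)
      \<longlongrightarrow> (t + \<delta> - t) * (max 0 (norm (Y t) - L * (t + \<delta> - t)))\<^sup>2) G"
    by (intro tendsto_intros node_cell_tendsto G lim)
  then show "((\<lambda>k. (node k (?j k) - node k (?i k)) * (max 0 (norm (y k (?i k)) - L * (node k (?j k) - node k (?i k))))\<^sup>2)
      \<longlongrightarrow> \<delta> * (max 0 (norm (Y t) - L * \<delta>))\<^sup>2) G" by simp
  have "eventually (\<lambda>k. t + \<delta> < real k) G"
    using eventually_sequentially_real_ge G(1) by (rule filter_leD[rotated])
  then show "eventually (\<lambda>k. (node k (?j k) - node k (?i k)) * (max 0 (norm (y k (?i k)) - L * (node k (?j k) - node k (?i k))))\<^sup>2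
      \<le> (\<Sum>l<?j k. mesh k * e k l) - (\<Sum>l<?i k. mesh k * e k l)) G"
    using eventually_node_cell[OF G(1), of "t + \<delta>"]
  proof eventually_elim
    case (elim k)
    have ij: "?i k \<le> ?j k" using \<open>\<delta> > 0\<close> by (intro cell_mono) simp
    define c where "c = max 0 (norm (y k (?i k)) - L * (node k (?j k) - node k (?i k)))"
    have c: "c\<^sup>2 \<le> e k l" if l: "l \<in> {?i k..<?j k}" for l
    proof -
      have n: "node k (?i k) \<le> node k l" "node k l \<le> node k (?j k)" using l by (auto intro: node_mono)
      have "norm (y k l - y k (?i k)) \<le> L * \<bar>node k l - node k (?i k)\<bar>"
        using n elim by (intro grid_lipschitz[of k "real k"] lip) auto
      also have "\<dots> \<le> L * (node k (?j k) - node k (?i k))"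
        using n \<open>L \<ge> 0\<close> by (intro mult_left_mono) auto
      finally have "c \<le> norm (y k l)"
        using norm_triangle_ineq2[of "y k (?i k)" "y k l"] by (simp add: c_def norm_minus_commute)
      moreover have "c \<ge> 0" by (simp add: c_def)
      ultimately have "c\<^sup>2 \<le> (norm (y k l))\<^sup>2" by (rule power_mono)
      with e show ?thesis by (rule order_trans[rotated])
    qed
    have "(node k (?j k) - node k (?i k)) * c\<^sup>2 = (\<Sum>l\<in>{?i k..<?j k}. mesh k * c\<^sup>2)"
      by (simp add: node_diff[OF ij])
    also have "\<dots> \<le> (\<Sum>l\<in>{?i k..<?j k}. mesh k * e k l)"
      using mesh_pos[of k] by (intro sum_mono mult_left_mono c) auto
    also have "\<dots> = (\<Sum>l<?j k. mesh k * e k l) - (\<Sum>l<?i k. mesh k * e k l)"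
      using ij by (simp add: sum_diff_nat_ivl lessThan_atLeast0)
    finally show ?case by (simp add: c_def)
  qed
qed

text \<open>A form of Barbalat's lemma: a bounded monotone \<open>\<Phi>\<close> has increments tending to \<open>0\<close> at both ends.\<close>
lemma tendsto_0_if_energy_finite:
  fixes Y :: "real \<Rightarrow> 'a::real_normed_vector"
  assumes "L \<ge> 0" and \<Phi>: "mono \<Phi>" "\<And>t. \<Phi> t \<in> {0..c}"
    and est: "\<And>t \<delta>. \<delta> > 0 \<Longrightarrow> \<delta> * (max 0 (norm (Y t) - L * \<delta>))\<^sup>2 \<le> \<Phi> (t + \<delta>) - \<Phi> t"
  shows "(Y \<longlongrightarrow> 0) at_top" "(Y \<longlongrightarrow> 0) at_bot"
proof -
  have bdd: "bdd_above (range \<Phi>)" "bdd_below (range \<Phi>)"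
    using \<Phi>(2) by (auto intro!: bdd_aboveI[of _ c] bdd_belowI[of _ 0])
  have main: "(Y \<longlongrightarrow> 0) F"
    if small: "\<And>\<eta> \<delta>. \<eta> > 0 \<Longrightarrow> \<delta> > 0 \<Longrightarrow> eventually (\<lambda>t. \<Phi> (t + \<delta>) - \<Phi> t < \<eta>) F" for F
  proof (rule tendstoI)
    fix \<epsilon> :: real assume "\<epsilon> > 0"
    \<comment> \<open>Within this time a path with Lipschitz constant \<open>L\<close> loses at most half of \<open>\<epsilon>\<close>.\<close>
    define \<delta> where "\<delta> = \<epsilon> / (2 * (L + 1))"
    have \<delta>: "\<delta> > 0" "L * \<delta> \<le> \<epsilon> / 2" using \<open>\<epsilon> > 0\<close> \<open>L \<ge> 0\<close> by (auto simp: \<delta>_def field_simps)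
    have "eventually (\<lambda>t. \<Phi> (t + \<delta>) - \<Phi> t < \<delta> * (\<epsilon> / 2)\<^sup>2) F"
      using \<delta> \<open>\<epsilon> > 0\<close> by (intro small) auto
    then show "eventually (\<lambda>t. dist (Y t) 0 < \<epsilon>) F"
    proof eventually_elim
      case (elim t)
      show ?case
      proof (rule ccontr)
        assume "\<not> dist (Y t) 0 < \<epsilon>"
        then have m: "\<epsilon> / 2 \<le> max 0 (norm (Y t) - L * \<delta>)" using \<delta> by (simp add: max_def)
        have "\<delta> * (\<epsilon> / 2)\<^sup>2 \<le> \<delta> * (max 0 (norm (Y t) - L * \<delta>))\<^sup>2"
          by (rule mult_left_mono[OF power_mono[OF m]]) (use \<delta> \<open>\<epsilon> > 0\<close> in auto)
        with est[OF \<delta>(1), of t] elim show False by linarith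
      qed
    qed
  qed
  show "(Y \<longlongrightarrow> 0) at_top"
  proof (rule main)
    fix \<eta> \<delta> :: real assume "\<eta> > 0" "\<delta> > 0"
    obtain T where T: "\<Phi> T > (SUP t. \<Phi> t) - \<eta>"
      using less_cSUP_iff[of UNIV \<Phi> "(SUP t. \<Phi> t) - \<eta>"] bdd \<open>\<eta> > 0\<close> by auto
    show "eventually (\<lambda>t. \<Phi> (t + \<delta>) - \<Phi> t < \<eta>) at_top"
      using eventually_ge_at_top[of T]
    proof eventually_elim
      case (elim t)
      then show ?case using monoD[OF \<Phi>(1) elim] T cSUP_upper[OF UNIV_I bdd(1), of "t + \<delta>"] by linarith
    qed
  qed
  show "(Y \<longlongrightarrow> 0) at_bot"
  proof (rule main)
    fix \<eta> \<delta> :: real assume "\<eta> > 0" "\<delta> > 0"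
    obtain T where T: "\<Phi> T < (INF t. \<Phi> t) + \<eta>"
      using cINF_less_iff[of UNIV \<Phi> "(INF t. \<Phi> t) + \<eta>"] bdd \<open>\<eta> > 0\<close> by auto
    show "eventually (\<lambda>t. \<Phi> (t + \<delta>) - \<Phi> t < \<eta>) at_bot"
      using eventually_le_at_bot[of "T - \<delta>"]
    proof eventually_elim
      case (elim t)
      then have "t + \<delta> \<le> T" by simp
      from monoD[OF \<Phi>(1) this] T cINF_lower[OF bdd(2) UNIV_I, of t] show ?case by linarith
    qed
  qed
qed

text \<open>The mean of the difference quotients over one unit of time is a difference of two values in the
  unit ball, and no quotient in this window differs from the first one by more than \<open>A\<close>.\<close>
lemma step_quot_bound_of_second:
  fixes q :: "nat \<Rightarrow> 'a::real_normed_vector"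
  assumes small: "\<And>i. norm (q i) \<le> 1"
    and second: "\<And>l. l < i + k \<Longrightarrow> norm (step_quot (mesh k) (step_quot (mesh k) q) l) \<le> A"
    and "A \<ge> 0"
  shows "norm (step_quot (mesh k) q i) \<le> 2 + A"
proof -
  let ?d = "step_quot (mesh k) q"
  have len: "node k (i + Suc k) - node k i = 1"
    by (subst node_diff) (simp_all add: mesh_def)
  have slope: "norm (?d l - ?d i) \<le> A" if l: "i \<le> l" "l < i + Suc k" for l
  proof -
    have "norm (step_quot (mesh k) ?d l' - 0) \<le> A" if "l' < l" for l'
      using second[of l'] that l by simp
    from increment_close_to_slope[OF l(1) this]
    have "norm (?d l - ?d i) \<le> A * (node k l - node k i)" by simp
    also have "\<dots> \<le> A * 1"
      using len node_mono[of l "i + Suc k" k] l \<open>A \<ge> 0\<close> by (intro mult_left_mono) auto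
    finally show ?thesis by simp
  qed
  from increment_close_to_slope[of i "i + Suc k" k q "?d i" A, OF le_add1 slope]
  have "norm (q (i + Suc k) - q i - ?d i) \<le> A"
    unfolding len by simp
  moreover have "norm (q (i + Suc k) - q i) \<le> 2"
    using norm_triangle_ineq4[of "q (i + Suc k)" "q i"] small[of "i + Suc k"] small[of i] by linarith
  ultimately show ?thesis
    using norm_triangle_ineq3[of "?d i" "q (i + Suc k) - q i"] by (simp add: norm_minus_commute)
qed

text \<open>The assumption \<open>r_close\<close> expresses consistency of the discretisation: the discrete right-hand sides
  approximate \<open>R\<close> locally uniformly.\<close>
lemma homoclinic_from_grid_solutions:
  fixes q r :: "nat \<Rightarrow> nat \<Rightarrow> 'a::euclidean_space" and R :: "real \<times> 'a \<Rightarrow> 'a"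
  defines "n \<equiv> \<lambda>k. 2 * (Suc k)\<^sup>2"
  assumes q: "\<And>k. q k \<in> grid_paths (n k)" "\<And>k. energy (mesh k) (n k) (q k) \<le> 1 / 2"
    and eq: "\<And>k i. Suc i < n k \<Longrightarrow>
      step_quot (mesh k) (q k) (Suc i) - step_quot (mesh k) (q k) i = mesh k *\<^sub>R r k (Suc i)"
    and r_bound: "\<And>k i. norm (r k i) \<le> A"
    and r_close: "\<And>t x \<epsilon>. \<epsilon> > 0 \<Longrightarrow> \<exists>\<delta>>0. \<forall>k i. mesh k < \<delta> \<longrightarrow> \<bar>node k i - t\<bar> < \<delta> \<longrightarrow>
      norm (q k i - x) < \<delta> \<longrightarrow> norm (r k i - R (t, x)) \<le> \<epsilon>"
  obtains Q D where "\<And>t. (Q has_vector_derivative D t) (at t)"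
    "\<And>t. (D has_vector_derivative R (t, Q t)) (at t)"
    "(Q \<longlongrightarrow> 0) at_top" "(Q \<longlongrightarrow> 0) at_bot" "(D \<longlongrightarrow> 0) at_top" "(D \<longlongrightarrow> 0) at_bot"
proof -
  define d where "d k = step_quot (mesh k) (q k)" for k
  define e where "e k l = (norm (d k l))\<^sup>2 + (norm (q k l))\<^sup>2" for k l
  define B where "B = 2 + A"
  have A0: "A \<ge> 0" using r_bound[of 0 0] norm_ge_zero order_trans by blast
  have q1: "norm (q k i) \<le> 1" for k i
    using mesh_pos q by (rule norm_le_1_if_energy_le_half)
  have dd: "step_quot (mesh k) (d k) i = r k (Suc i)" if "Suc i < n k" for k i
    using eq[OF that] mesh_pos[of k] unfolding step_quot_def[of _ "d k"] by (simp add: d_def)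
  \<comment> \<open>Nodes before time \<open>k\<close> have a whole unit of time to their right inside the grid.\<close>
  have inside: "l + Suc k < n k" if "node k l < real k" for k l
  proof -
    have "real l < (2 * real k + 1) * real (Suc k)"
      using that by (simp add: node_def mesh_def field_simps)
    then have "real l < real ((2 * k + 1) * Suc k)" by (simp add: algebra_simps)
    then have "l < (2 * k + 1) * Suc k" by (simp only: of_nat_less_iff)
    then show ?thesis by (simp add: n_def power2_eq_square)
  qed
  have dd_bound: "norm (step_quot (mesh k) (d k) l) \<le> A" if "node k l < real k" for k l
    using inside[OF that] r_bound by (subst dd) auto
  have d_bound: "norm (d k l) \<le> B" if "node k l < real k" for k l
    unfolding d_def B_def
    by (rule step_quot_bound_of_second[OF q1 _ A0], fold d_def, subst dd)
      (use inside[OF that] r_bound in auto)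
  have e0: "e k l \<ge> 0" for k l by (simp add: e_def)
  have esum: "(\<Sum>l<N. mesh k * e k l) \<le> 1 / 2" for k N
  proof -
    have "(\<Sum>l<N. mesh k * e k l) \<le> (\<Sum>l<max N (n k). mesh k * e k l)"
      using mesh_pos[of k] e0 by (intro sum_mono2) auto
    also have "\<dots> = (\<Sum>l<n k. mesh k * e k l)"
      using q(1)[of k]
      by (intro sum.mono_neutral_right) (auto simp: e_def d_def grid_paths_def step_quot_def)
    also have "\<dots> \<le> 1 / 2" using q(2)[of k] by (simp add: energy_def e_def d_def)
    finally show ?thesis .
  qed
  \<comment> \<open>Path, velocity and energy up to time \<open>t\<close> must converge along the same filter.\<close>
  define z where "z k t = (q k (cell k t), d k (cell k t), \<Sum>l<cell k t. mesh k * e k l)" for k t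
  have "Bseq (\<lambda>k. z k t)" for t
  proof (rule BfunI)
    show "eventually (\<lambda>k. norm (z k t) \<le> 1 + (B + 1 / 2)) sequentially"
      using eventually_sequentially_real_ge[of t] eventually_node_cell[OF order_refl, of t]
    proof eventually_elim
      case (elim k)
      have "norm (\<Sum>l<cell k t. mesh k * e k l) \<le> 1 / 2"
        using esum[where k = k] mesh_pos[of k] e0 by (simp add: sum_nonneg)
      with d_bound[of k "cell k t"] elim
      have "norm (d k (cell k t), \<Sum>l<cell k t. mesh k * e k l) \<le> B + 1 / 2"
        using norm_Pair_le[of "d k (cell k t)" "\<Sum>l<cell k t. mesh k * e k l"] by linarith
      then show ?case
        using q1[of k "cell k t"] norm_Pair_le[of "q k (cell k t)" "(d k (cell k t), \<Sum>l<cell k t. mesh k * e k l)"]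
        unfolding z_def by linarith
    qed
  qed
  then obtain G x where G: "G \<le> sequentially" "G \<noteq> bot" and x: "\<And>t. ((\<lambda>k. z k t) \<longlongrightarrow> x t) G"
    by (rule pointwise_limit_along_subfilter[of z]) (rule that)
  define Q where "Q t = fst (x t)" for t
  define D where "D t = fst (snd (x t))" for t
  define \<Phi> where "\<Phi> t = snd (snd (x t))" for t
  have Q: "((\<lambda>k. q k (cell k t)) \<longlongrightarrow> Q t) G" for t
    using tendsto_fst[OF x[of t]] by (simp add: z_def Q_def)
  have D: "((\<lambda>k. d k (cell k t)) \<longlongrightarrow> D t) G" for t
    using tendsto_fst[OF tendsto_snd[OF x[of t]]] by (simp add: z_def D_def)
  have \<Phi>: "((\<lambda>k. \<Sum>l<cell k t. mesh k * e k l) \<longlongrightarrow> \<Phi> t) G" for t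
    using tendsto_snd[OF tendsto_snd[OF x[of t]]] by (simp add: z_def \<Phi>_def)

  \<comment> \<open>Uniformly Lipschitz grid functions converge uniformly near \<open>t\<close>, not only at \<open>t\<close>.\<close>
  have near: "\<exists>\<delta>>0. eventually (\<lambda>k. \<forall>l. \<bar>node k l - t\<bar> < \<delta> \<longrightarrow> node k l < real k \<and> norm (y k l - Y t) < \<epsilon>) G"
    if "\<epsilon> > 0" "L \<ge> 0" and lim: "((\<lambda>k. y k (cell k t)) \<longlongrightarrow> Y t) G"
      and lip: "\<And>k l. node k l < real k \<Longrightarrow> norm (step_quot (mesh k) (y k) l) \<le> L"
    for y :: "nat \<Rightarrow> nat \<Rightarrow> 'a" and Y t \<epsilon> L
  proof (intro exI conjI)
    define \<delta> where "\<delta> = min 1 (\<epsilon> / (4 * (L + 1)))"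
    show "\<delta> > 0" using that by (simp add: \<delta>_def)
    have "L * (2 * \<delta>) \<le> (L + 1) * (2 * (\<epsilon> / (4 * (L + 1))))"
      using \<open>L \<ge> 0\<close> \<open>\<delta> > 0\<close> by (intro mult_mono) (auto simp: \<delta>_def)
    also have "\<dots> = \<epsilon> / 2" using \<open>L \<ge> 0\<close> by (simp add: field_simps)
    finally have L\<delta>: "L * (2 * \<delta>) \<le> \<epsilon> / 2" .
    have "eventually (\<lambda>k. mesh k < \<delta>) sequentially"
      using mesh_tendsto_0 \<open>\<delta> > 0\<close> by (rule order_tendstoD(2))
    with G(1) have "eventually (\<lambda>k. mesh k < \<delta>) G" by (rule filter_leD)
    moreover have "eventually (\<lambda>k. t + 1 < real k) G"
      using eventually_sequentially_real_ge G(1) by (rule filter_leD[rotated])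
    moreover have "eventually (\<lambda>k. dist (y k (cell k t)) (Y t) < \<epsilon> / 2) G"
      using lim \<open>\<epsilon> > 0\<close> by (intro tendstoD) auto
    ultimately show "eventually (\<lambda>k. \<forall>l. \<bar>node k l - t\<bar> < \<delta> \<longrightarrow> node k l < real k \<and> norm (y k l - Y t) < \<epsilon>) G"
      using eventually_node_cell[OF G(1), of t]
    proof eventually_elim
      case (elim k)
      show ?case
      proof (intro allI impI)
        fix l assume l: "\<bar>node k l - t\<bar> < \<delta>"
        have "\<delta> \<le> 1" by (simp add: \<delta>_def)
        then have lk: "node k l < real k" using l elim by linarith
        have "norm (y k l - y k (cell k t)) \<le> L * \<bar>node k l - node k (cell k t)\<bar>"
          using elim lk by (intro grid_lipschitz[of k "real k"] lip) auto
        also have "\<dots> \<le> L * (2 * \<delta>)"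
          using elim l \<open>L \<ge> 0\<close> by (intro mult_left_mono) auto
        finally have "norm (y k l - y k (cell k t)) \<le> \<epsilon> / 2" using L\<delta> by linarith
        then have "norm (y k l - Y t) < \<epsilon>"
          using elim norm_triangle_ineq[of "y k l - y k (cell k t)" "y k (cell k t) - Y t"]
          by (simp add: dist_norm)
        with lk show "node k l < real k \<and> norm (y k l - Y t) < \<epsilon>" by simp
      qed
    qed
  qed

  have Q': "(Q has_vector_derivative D t) (at t)" for t
  proof (rule grid_limit_has_vector_derivative[where y = q and Y = Q, OF G Q])
    fix \<epsilon> :: real assume "\<epsilon> > 0"
    obtain \<delta> where "\<delta> > 0" and ev: "eventually (\<lambda>k. \<forall>l. \<bar>node k l - t\<bar> < \<delta> \<longrightarrow>
        node k l < real k \<and> norm (d k l - D t) < \<epsilon>) G"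
      using near[where y = d and Y = D, OF \<open>\<epsilon> > 0\<close> A0 D dd_bound] by blast
    from ev have "eventually (\<lambda>k. \<forall>l. \<bar>node k l - t\<bar> < \<delta> \<longrightarrow> norm (step_quot (mesh k) (q k) l - D t) \<le> \<epsilon>) G"
      by eventually_elim (auto simp: d_def[symmetric] intro: less_imp_le)
    with \<open>\<delta> > 0\<close> show "\<exists>\<delta>>0. eventually (\<lambda>k. \<forall>l. \<bar>node k l - t\<bar> < \<delta> \<longrightarrow> norm (step_quot (mesh k) (q k) l - D t) \<le> \<epsilon>) G"
      by blast
  qed
  have B0: "B \<ge> 0" using A0 by (simp add: B_def)
  have q_lip: "norm (step_quot (mesh k) (q k) l) \<le> B" if "node k l < real k" for k l
    using d_bound[OF that] by (simp add: d_def)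
  have D': "(D has_vector_derivative R (t, Q t)) (at t)" for t
  proof (rule grid_limit_has_vector_derivative[where y = d and Y = D, OF G D])
    fix \<epsilon> :: real assume "\<epsilon> > 0"
    from r_close[OF this, of t "Q t"] obtain \<delta> where "\<delta> > 0" and
      \<delta>: "\<And>k i. mesh k < \<delta> \<Longrightarrow> \<bar>node k i - t\<bar> < \<delta> \<Longrightarrow> norm (q k i - Q t) < \<delta> \<Longrightarrow>
            norm (r k i - R (t, Q t)) \<le> \<epsilon>" by blast
    obtain \<eta> where "\<eta> > 0" and ev: "eventually (\<lambda>k. \<forall>l. \<bar>node k l - t\<bar> < \<eta> \<longrightarrow>
        node k l < real k \<and> norm (q k l - Q t) < \<delta>) G"
      using near[where y = q and Y = Q, OF \<open>\<delta> > 0\<close> B0 Q q_lip] by blast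
    define \<eta>' where "\<eta>' = min \<eta> \<delta> / 2"
    have \<eta>': "\<eta>' > 0" "2 * \<eta>' \<le> \<eta>" "2 * \<eta>' \<le> \<delta>"
      using \<open>\<eta> > 0\<close> \<open>\<delta> > 0\<close> by (auto simp: \<eta>'_def)
    have "eventually (\<lambda>k. mesh k < \<eta>') sequentially"
      using mesh_tendsto_0 \<open>\<eta>' > 0\<close> by (rule order_tendstoD(2))
    with G(1) have "eventually (\<lambda>k. mesh k < \<eta>') G" by (rule filter_leD)
    with ev have "eventually (\<lambda>k. \<forall>l. \<bar>node k l - t\<bar> < \<eta>' \<longrightarrow> norm (step_quot (mesh k) (d k) l - R (t, Q t)) \<le> \<epsilon>) G"
    proof eventually_elim
      case (elim k)
      show ?case
      proof (intro allI impI)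
        fix l assume l: "\<bar>node k l - t\<bar> < \<eta>'"
        have "\<bar>node k l - t\<bar> < \<eta>" using l \<eta>' by linarith
        then have "Suc l < n k" using elim(1) inside[of k l] by simp
        moreover have Sl: "\<bar>node k (Suc l) - t\<bar> < 2 * \<eta>'"
          using l elim(2) mesh_pos[of k] by (simp add: node_Suc)
        moreover have "norm (q k (Suc l) - Q t) < \<delta>" using elim(1) Sl \<eta>' by simp
        ultimately show "norm (step_quot (mesh k) (d k) l - R (t, Q t)) \<le> \<epsilon>"
          using elim(2) \<eta>' by (simp add: dd \<delta>)
      qed
    qed
    with \<open>\<eta>' > 0\<close> show "\<exists>\<delta>>0. eventually (\<lambda>k. \<forall>l. \<bar>node k l - t\<bar> < \<delta> \<longrightarrow> norm (step_quot (mesh k) (d k) l - R (t, Q t)) \<le> \<epsilon>) G"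
      by blast
  qed

  have "mono \<Phi>"
  proof (rule monoI)
    fix s t :: real assume "s \<le> t"
    have "(\<Sum>l<cell k s. mesh k * e k l) \<le> (\<Sum>l<cell k t. mesh k * e k l)" for k
      using cell_mono[OF \<open>s \<le> t\<close>, of k] mesh_pos[of k] e0 by (intro sum_mono2) auto
    then show "\<Phi> s \<le> \<Phi> t" by (intro tendsto_le[OF G(2) \<Phi> \<Phi>]) simp
  qed
  moreover have "\<Phi> t \<in> {0..1 / 2}" for t
  proof -
    have "0 \<le> \<Phi> t"
      using mesh_pos e0 by (intro tendsto_lowerbound[OF \<Phi> _ G(2)] always_eventually allI sum_nonneg) (simp add: less_imp_le)
    moreover have "\<Phi> t \<le> 1 / 2"
      using esum by (intro tendsto_upperbound[OF \<Phi> _ G(2)] always_eventually allI)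
    ultimately show ?thesis by simp
  qed
  ultimately have decay: "(Y \<longlongrightarrow> 0) at_top \<and> (Y \<longlongrightarrow> 0) at_bot"
    if "L \<ge> 0" and "\<And>t. ((\<lambda>k. y k (cell k t)) \<longlongrightarrow> Y t) G" "\<And>k l. (norm (y k l))\<^sup>2 \<le> e k l"
      "\<And>k l. node k l < real k \<Longrightarrow> norm (step_quot (mesh k) (y k) l) \<le> L"
    for y :: "nat \<Rightarrow> nat \<Rightarrow> 'a" and Y L
    using tendsto_0_if_energy_finite[OF \<open>L \<ge> 0\<close>, of \<Phi> "1 / 2" Y]
      grid_limit_energy_estimate[where y = y and Y = Y and e = e and \<Phi> = \<Phi>, OF G that(2) \<Phi> that(3,4,1)] by blast
  show ?thesis
    using that[of Q D] Q' D' decay[OF B0 Q _ q_lip] decay[OF A0 D _ dd_bound]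
    by (simp add: e_def)
qed

section \<open>Gradients and superquadratic potentials\<close>

lemma grad_q_eqI:
  assumes "GDERIV (\<lambda>x. F (t, x)) q :> D"
  shows "grad_q F (t, q) = D"
proof -
  have "D' = D" if "GDERIV (\<lambda>x. F (t, x)) q :> D'" for D'
  proof -
    have "(\<lambda>v. v \<bullet> D') = (\<lambda>v. v \<bullet> D)"
      using has_derivative_unique that assms unfolding gderiv_def by blast
    then show ?thesis by (metis vector_eq_ldot)
  qed
  with assms show ?thesis
    unfolding grad_q_def prod.case by (intro the_equality)
qed

text \<open>The gradient in \<open>q\<close> is read off from the derivative in both variables, restricted to directions
  \<open>(0, v)\<close>; this also shows that it is jointly continuous.\<close>
lemma C1_smooth_gradient:
  assumes "C1_smooth F"
  shows GDERIV_grad_q: "GDERIV (\<lambda>x. F (t, x)) q :> grad_q F (t, q)"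
    and continuous_grad_q: "continuous_on UNIV (grad_q F)"
proof -
  obtain F' where F': "\<And>p. (F has_derivative blinfun_apply (F' p)) (at p)"
    and cont: "continuous_on UNIV F'"
    using assms unfolding C1_smooth_def by blast
  define g where "g p = (\<Sum>b\<in>Basis. blinfun_apply (F' p) (0, b) *\<^sub>R b)" for p
  have g: "GDERIV (\<lambda>x. F (t, x)) q :> g (t, q)" for t q
  proof -
    have "((\<lambda>x. (t, x)) has_derivative (\<lambda>v. (0, v))) (at q)"
      by (auto intro!: derivative_eq_intros)
    from has_derivative_compose[OF this F']
    have "((\<lambda>x. F (t, x)) has_derivative (\<lambda>v. F' (t, q) (0, v))) (at q)" .
    moreover have "F' (t, q) (0, v) = v \<bullet> g (t, q)" for v
    proof -
      have "linear (\<lambda>v. F' (t, q) (0, v))"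
        by (intro bounded_linear.linear bounded_linear_intros)
      from Linear_Algebra.linear_componentwise[OF this, of v 1]
      show ?thesis by (simp add: g_def inner_sum_right mult.commute)
    qed
    ultimately show ?thesis by (simp add: gderiv_def)
  qed
  then have "grad_q F = g" using grad_q_eqI by fast
  with g show "GDERIV (\<lambda>x. F (t, x)) q :> grad_q F (t, q)" by simp
  show "continuous_on UNIV (grad_q F)"
    unfolding \<open>grad_q F = g\<close> g_def
    by (intro continuous_intros cont)
qed

lemma DERIV_along_ray:
  assumes "\<And>x. GDERIV w x :> g x"
  shows "((\<lambda>s. w (s *\<^sub>R x)) has_real_derivative x \<bullet> g (s *\<^sub>R x)) (at s)"
proof -
  have "((\<lambda>s. s *\<^sub>R x) has_derivative (\<lambda>u. u *\<^sub>R x)) (at s)"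
    by (auto intro!: derivative_eq_intros)
  from has_derivative_compose[OF this assms[unfolded gderiv_def]]
  show ?thesis
    unfolding has_field_derivative_def
    by (rule has_derivative_eq_rhs) (simp add: fun_eq_iff)
qed

text \<open>The assumption says that \<open>w(u x) / u\<^sup>2\<close> has nonnegative derivative in \<open>u\<close>.\<close>
lemma superquadratic_on_rays:
  assumes g: "\<And>x. GDERIV w x :> g x"
    and sup: "\<And>x. x \<noteq> 0 \<Longrightarrow> 2 * w x \<le> x \<bullet> g x"
    and "x \<noteq> 0" "0 < s" "s \<le> 1"
  shows "w (s *\<^sub>R x) \<le> s\<^sup>2 * w x"
proof -
  have "w (s *\<^sub>R x) / s\<^sup>2 \<le> w (1 *\<^sub>R x) / 1\<^sup>2"
  proof (rule DERIV_nonneg_imp_nondecreasing[OF \<open>s \<le> 1\<close>])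
    fix u :: real assume "s \<le> u" "u \<le> 1"
    with \<open>0 < s\<close> have u: "u > 0" by simp
    have "((\<lambda>u. w (u *\<^sub>R x) / u\<^sup>2) has_real_derivative
        ((u *\<^sub>R x) \<bullet> g (u *\<^sub>R x) - 2 * w (u *\<^sub>R x)) / u ^ 3) (at u)"
      using u by (auto intro!: derivative_eq_intros DERIV_along_ray[OF g]
          simp: field_simps power2_eq_square power3_eq_cube)
    moreover have "((u *\<^sub>R x) \<bullet> g (u *\<^sub>R x) - 2 * w (u *\<^sub>R x)) / u ^ 3 \<ge> 0"
      using u \<open>x \<noteq> 0\<close> sup[of "u *\<^sub>R x"] by simp
    ultimately show "\<exists>y. ((\<lambda>u. w (u *\<^sub>R x) / u\<^sup>2) has_real_derivative y) (at u) \<and> 0 \<le> y" by blast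
  qed
  then show ?thesis using \<open>0 < s\<close> by (simp add: divide_le_eq mult.commute)
qed

lemma superquadratic_at_0:
  fixes w :: "'a::euclidean_space \<Rightarrow> real"
  assumes g: "\<And>x. GDERIV w x :> g x"
    and sup: "\<And>x. x \<noteq> 0 \<Longrightarrow> 2 * w x \<le> x \<bullet> g x"
    and pos: "\<And>x. x \<noteq> 0 \<Longrightarrow> 0 < w x"
  shows "w 0 = 0"
proof -
  obtain b :: 'a where "b \<in> Basis" using nonempty_Basis by blast
  then have b: "b \<noteq> 0" by (rule nonzero_Basis)
  have ray: "((\<lambda>s. w (s *\<^sub>R b)) \<longlongrightarrow> w 0) (at_right 0)"
    using DERIV_isCont[OF DERIV_along_ray[OF g, of b 0]]
    by (simp add: isCont_def filterlim_at_split)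
  have s: "eventually (\<lambda>s::real. s \<in> {0<..<1}) (at_right 0)"
    by (rule eventually_at_right_real) simp
  have "w 0 \<ge> 0"
    using s by (intro tendsto_lowerbound[OF ray])
      (auto elim!: eventually_mono intro!: less_imp_le pos simp: b)
  moreover have "w 0 \<le> 0\<^sup>2 * w b"
  proof (rule tendsto_le[OF _ _ ray])
    show "((\<lambda>s::real. s\<^sup>2 * w b) \<longlongrightarrow> 0\<^sup>2 * w b) (at_right 0)" by (intro tendsto_intros)
  qed (use s in \<open>auto elim!: eventually_mono intro!: superquadratic_on_rays[OF g sup b]\<close>)
  ultimately show ?thesis by simp
qed

text \<open>Comparing \<open>x\<close> with its radial projection to the unit sphere. The gradient bound makes the supremum
  finite, without which \<open>Sup\<close> would be unspecified.\<close>
lemma superquadratic_le_sup_on_sphere: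
  fixes w :: "real \<Rightarrow> 'a::euclidean_space \<Rightarrow> real"
  assumes g: "\<And>t x. GDERIV (w t) x :> g t x"
    and sup: "\<And>t x. x \<noteq> 0 \<Longrightarrow> 2 * w t x \<le> x \<bullet> g t x"
    and pos: "\<And>t x. x \<noteq> 0 \<Longrightarrow> 0 < w t x"
    and bound: "\<And>t x. norm x \<le> 1 \<Longrightarrow> norm (g t x) \<le> C"
    and "norm x \<le> 1"
  shows "w t x \<le> Sup {w t x | t x. norm x = 1} * (norm x)\<^sup>2"
    and "0 \<le> Sup {w t x | t x. norm x = 1}"
proof -
  let ?S = "{w t x | t x. norm x = 1}"
  have w0: "w t 0 = 0" for t using g sup pos by (rule superquadratic_at_0)
  have "w t u \<le> C" if "norm u = 1" for t u
  proof -
    obtain s where s: "0 < s" "s < 1" "w t (1 *\<^sub>R u) - w t (0 *\<^sub>R u) = (1 - 0) * (u \<bullet> g t (s *\<^sub>R u))"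
      using MVT2[of 0 1 "\<lambda>s. w t (s *\<^sub>R u)" "\<lambda>s. u \<bullet> g t (s *\<^sub>R u)"] DERIV_along_ray[OF g] by auto
    then have "w t u = u \<bullet> g t (s *\<^sub>R u)" by (simp add: w0)
    also have "\<dots> \<le> norm u * norm (g t (s *\<^sub>R u))" by (rule norm_cauchy_schwarz)
    also have "\<dots> \<le> C" using s that by (simp add: bound)
    finally show ?thesis .
  qed
  then have bdd: "bdd_above ?S" by (auto intro!: bdd_aboveI[of _ C])
  have sphere: "w t u \<le> Sup ?S" if "norm u = 1" for t u
    using that by (auto intro!: cSup_upper bdd)
  obtain b :: 'a where "b \<in> Basis" using nonempty_Basis by blast
  then have "norm b = 1" by simp
  moreover from this have "b \<noteq> 0" by auto
  ultimately show "0 \<le> Sup ?S" using sphere[of b undefined] pos[of b undefined] by linarith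
  show "w t x \<le> Sup ?S * (norm x)\<^sup>2"
  proof (cases "x = 0")
    case True
    then show ?thesis by (simp add: w0)
  next
    case False
    define u where "u = x /\<^sub>R norm x"
    have u: "norm u = 1" "u \<noteq> 0" "x = norm x *\<^sub>R u" using False by (auto simp: u_def)
    have "w t (norm x *\<^sub>R u) \<le> (norm x)\<^sup>2 * w t u"
      using False \<open>norm x \<le> 1\<close> u(2) by (intro superquadratic_on_rays[OF g sup]) auto
    also have "\<dots> \<le> (norm x)\<^sup>2 * Sup ?S" using sphere[OF u(1)] by (intro mult_left_mono) auto
    finally show ?thesis unfolding u(3)[symmetric] by (simp add: mult.commute)
  qed
qed

section \<open>Existence of the homoclinic solution\<close>

text \<open>Sampling at minimisers over the cells gives lower Riemann sums, so the discrete norm of the forcing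
  never exceeds its \<open>L\<^sup>2\<close>-norm and the strict smallness assumption carries over to every grid.\<close>
lemma sum_cell_minima_le_integral:
  fixes g :: "real \<Rightarrow> real"
  assumes g: "continuous_on UNIV g" "integrable lborel g" "\<And>t. g t \<ge> 0"
    and m: "\<And>i t. node k i \<le> t \<Longrightarrow> t \<le> node k (Suc i) \<Longrightarrow> m i \<le> g t"
  shows "(\<Sum>i<N. mesh k * m i) \<le> (LINT t|lborel. g t)"
proof -
  have cont: "continuous_on S g" for S using g(1) by (rule continuous_on_subset) simp
  have "(\<Sum>i<N. mesh k * m i) \<le> integral {node k 0..node k N} g"
  proof (induction N)
    case 0
    then show ?case by simp
  next
    case (Suc N)
    have "mesh k * m N = integral {node k N..node k (Suc N)} (\<lambda>_. m N)"
      using mesh_pos[of k] by (simp add: node_Suc)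
    also have "\<dots> \<le> integral {node k N..node k (Suc N)} g"
      by (intro integral_le integrable_continuous_real cont continuous_on_const) (auto intro: m)
    finally have "(\<Sum>i<Suc N. mesh k * m i)
        \<le> integral {node k 0..node k N} g + integral {node k N..node k (Suc N)} g"
      using Suc by simp
    also have "\<dots> = integral {node k 0..node k (Suc N)} g"
      by (intro Henstock_Kurzweil_Integration.integral_combine integrable_continuous_real cont node_mono) auto
    finally show ?case .
  qed
  also have "\<dots> = (LINT t:{node k 0..node k N}|lborel. g t)"
    by (rule set_borel_integral_eq_integral(2)[symmetric])
      (simp add: borel_integrable_atLeastAtMost' cont)
  also have "\<dots> \<le> (LINT t|lborel. g t)"
    unfolding set_lebesgue_integral_def
    using g by (intro integral_mono integrable_mult_indicator) (auto simp: indicator_def)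
  finally show ?thesis .
qed

text \<open>Each grid problem uses \<open>U\<close> at the nodes and \<open>f\<close> at a point of the cell where \<open>|f|\<close> is least.
  Continuity of \<open>g\<close> and \<open>f\<close> makes these discretisations consistent with \<open>q'' = g(t, q) + f(t)\<close>.\<close>
lemma homoclinic_of_small_forcing:
  fixes U :: "real \<times> 'a::euclidean_space \<Rightarrow> real" and g :: "real \<times> 'a \<Rightarrow> 'a"
  assumes U: "\<And>t x. GDERIV (\<lambda>x. U (t, x)) x :> g (t, x)" "\<And>t. U (t, 0) = 0"
      "\<And>t x. norm x \<le> 1 \<Longrightarrow> c * (norm x)\<^sup>2 \<le> U (t, x)"
    and g: "continuous_on UNIV g" "\<And>t x. norm x \<le> 1 \<Longrightarrow> norm (g (t, x)) \<le> C"
    and c: "0 < c" "c \<le> 1 / 2"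
    and f: "continuous_on UNIV f" "bounded (range f)" "integrable lborel (\<lambda>t. (norm (f t))\<^sup>2)"
      "sqrt (LINT t|lborel. (norm (f t))\<^sup>2) < c / sqrt 2"
  obtains Q D where "\<And>t. (Q has_vector_derivative D t) (at t)"
    "\<And>t. (D has_vector_derivative g (t, Q t) + f t) (at t)"
    "(Q \<longlongrightarrow> 0) at_top" "(Q \<longlongrightarrow> 0) at_bot" "(D \<longlongrightarrow> 0) at_top" "(D \<longlongrightarrow> 0) at_bot"
proof -
  define \<phi> where "\<phi> = sqrt (LINT t|lborel. (norm (f t))\<^sup>2)"
  have "\<exists>s\<in>{node k i..node k (Suc i)}. \<forall>t\<in>{node k i..node k (Suc i)}. norm (f s) \<le> norm (f t)" for k i
    using f(1) node_mono[of i "Suc i" k]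
    by (intro continuous_attains_inf compact_Icc continuous_on_norm) (auto intro: continuous_on_subset)
  then obtain \<sigma> where \<sigma>: "\<And>k i. \<sigma> k i \<in> {node k i..node k (Suc i)}"
    and \<sigma>_min: "\<And>k i t. t \<in> {node k i..node k (Suc i)} \<Longrightarrow> norm (f (\<sigma> k i)) \<le> norm (f t)"
    by metis
  have F: "(\<Sum>i<N. mesh k * (norm (f (\<sigma> k i)))\<^sup>2) \<le> \<phi>\<^sup>2" for k N
  proof -
    have "(\<Sum>i<N. mesh k * (norm (f (\<sigma> k i)))\<^sup>2) \<le> (LINT t|lborel. (norm (f t))\<^sup>2)"
      by (rule sum_cell_minima_le_integral)
        (use f \<sigma>_min in \<open>auto intro!: continuous_intros power_mono\<close>)
    then show ?thesis by (simp add: \<phi>_def)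
  qed
  have "\<exists>q. q \<in> grid_paths (2 * (Suc k)\<^sup>2) \<and> energy (mesh k) (2 * (Suc k)\<^sup>2) q \<le> 1 / 2 \<and>
      (\<forall>i. Suc i < 2 * (Suc k)\<^sup>2 \<longrightarrow> step_quot (mesh k) q (Suc i) - step_quot (mesh k) q i
         = mesh k *\<^sub>R (g (node k (Suc i), q (Suc i)) + f (\<sigma> k (Suc i))))" for k
    by (rule discrete_minimiser[where U = "\<lambda>i x. U (node k i, x)" and g = "\<lambda>i x. g (node k i, x)"
          and F = "\<lambda>i. f (\<sigma> k i)" and h = "mesh k" and c = c and \<phi> = \<phi> and n = "2 * (Suc k)\<^sup>2"])
      (fact c U F mesh_pos f(4)[folded \<phi>_def] | simp add: \<phi>_def | blast)+
  then obtain q where q: "\<And>k. q k \<in> grid_paths (2 * (Suc k)\<^sup>2)"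
      "\<And>k. energy (mesh k) (2 * (Suc k)\<^sup>2) (q k) \<le> 1 / 2"
    and eq: "\<And>k i. Suc i < 2 * (Suc k)\<^sup>2 \<Longrightarrow> step_quot (mesh k) (q k) (Suc i) - step_quot (mesh k) (q k) i
         = mesh k *\<^sub>R (g (node k (Suc i), q k (Suc i)) + f (\<sigma> k (Suc i)))"
    by metis
  obtain B where B: "\<And>t. norm (f t) \<le> B" using f(2) unfolding bounded_iff by auto
  have q1: "norm (q k i) \<le> 1" for k i
    using mesh_pos q by (rule norm_le_1_if_energy_le_half)
  show ?thesis
  proof (rule homoclinic_from_grid_solutions[where q = q and A = "C + B"
        and r = "\<lambda>k i. g (node k i, q k i) + f (\<sigma> k i)" and R = "\<lambda>(t, x). g (t, x) + f t"])
    fix k i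
    show "norm (g (node k i, q k i) + f (\<sigma> k i)) \<le> C + B"
      by (intro norm_triangle_mono g(2) q1 B)
  next
    fix t x and \<epsilon> :: real assume "\<epsilon> > 0"
    have "continuous (at (t, x)) g"
      using g(1) by (simp add: continuous_on_eq_continuous_at)
    then obtain \<delta>1 where \<delta>1: "\<delta>1 > 0" "\<And>p. dist p (t, x) < \<delta>1 \<Longrightarrow> dist (g p) (g (t, x)) < \<epsilon> / 2"
      using \<open>\<epsilon> > 0\<close> unfolding continuous_at_eps_delta by (metis half_gt_zero)
    have "continuous (at t) f"
      using f(1) by (simp add: continuous_on_eq_continuous_at)
    then obtain \<delta>2 where \<delta>2: "\<delta>2 > 0" "\<And>s. dist s t < \<delta>2 \<Longrightarrow> dist (f s) (f t) < \<epsilon> / 2"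
      using \<open>\<epsilon> > 0\<close> unfolding continuous_at_eps_delta by (metis half_gt_zero)
    define \<delta> where "\<delta> = min \<delta>1 \<delta>2 / 2"
    have \<delta>: "\<delta> > 0" "2 * \<delta> \<le> \<delta>1" "2 * \<delta> \<le> \<delta>2" using \<delta>1 \<delta>2 by (auto simp: \<delta>_def)
    have "norm (g (node k i, q k i) + f (\<sigma> k i) - (g (t, x) + f t)) \<le> \<epsilon>"
      if "mesh k < \<delta>" "\<bar>node k i - t\<bar> < \<delta>" "norm (q k i - x) < \<delta>" for k i
    proof -
      have "dist (node k i, q k i) (t, x) \<le> \<bar>node k i - t\<bar> + norm (q k i - x)"
        using norm_Pair_le[of "node k i - t" "q k i - x"] by (simp add: dist_norm)
      then have "dist (g (node k i, q k i)) (g (t, x)) < \<epsilon> / 2"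
        using that \<delta> by (intro \<delta>1) linarith
      moreover have "dist (f (\<sigma> k i)) (f t) < \<epsilon> / 2"
        using \<sigma>[of k i] that \<delta> by (intro \<delta>2) (auto simp: node_Suc dist_real_def)
      ultimately show ?thesis
        using norm_triangle_ineq[of "g (node k i, q k i) - g (t, x)" "f (\<sigma> k i) - f t"]
        by (simp add: dist_norm algebra_simps)
    qed
    with \<delta>(1) show "\<exists>\<delta>>0. \<forall>k i. mesh k < \<delta> \<longrightarrow> \<bar>node k i - t\<bar> < \<delta> \<longrightarrow> norm (q k i - x) < \<delta> \<longrightarrow>
        norm (g (node k i, q k i) + f (\<sigma> k i) - (case (t, x) of (t, x) \<Rightarrow> g (t, x) + f t)) \<le> \<epsilon>"
      by auto
  qed (fact q eq | (rule that; simp))+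
qed

theorem theorem1p1:
  fixes V K W :: "real \<times> (real ^ 'n::finite) \<Rightarrow> real"
    and f :: "real \<Rightarrow> real ^ 'n"
    and b1 b2 \<mu> m M b1bar :: real
  assumes V: "\<And>t q. V (t, q) = - K (t, q) + W (t, q)"
    and K_C1: "C1_smooth K"
    and W_C1: "C1_smooth W"
    and C1: "unif_bounded_in_time (grad_q K)" "unif_bounded_in_time (grad_q W)"
    and C2: "b1 > 0" "b2 > 0"
      "\<And>t q. b1 * (norm q)\<^sup>2 \<le> K (t, q) \<and> K (t, q) \<le> b2 * (norm q)\<^sup>2"
    and C3: "\<And>t q. K (t, q) \<le> q \<bullet> grad_q K (t, q) \<and> q \<bullet> grad_q K (t, q) \<le> 2 * K (t, q)"
    and C4: "uniform_limit UNIV (\<lambda>q t. grad_q W (t, q) /\<^sub>R norm q) (\<lambda>t. 0) (at 0)"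
    and C5: "\<mu> > 2"
      "\<And>t q. q \<noteq> 0 \<Longrightarrow> 0 < \<mu> * W (t, q) \<and> \<mu> * W (t, q) \<le> q \<bullet> grad_q W (t, q)"
    and m_def: "m = Inf {W (t, q) | t q. norm q = 1}"
    and C6: "m > 0"
    and M_def: "M = Sup {W (t, q) | t q. norm q = 1}"
    and b1bar_def: "b1bar = min 1 (2 * b1)"
    and M_less: "M < 1 / 2 * b1bar"
    and f_cont: "continuous_on UNIV f"
    and f_bounded: "bounded (range f)"
    and f_L2: "integrable lborel (\<lambda>t. (norm (f t))\<^sup>2)"
    and f_small: "sqrt (LINT t|lborel. (norm (f t))\<^sup>2) < sqrt 2 / 4 * (b1bar - 2 * M)"
  shows "\<exists>q. solution V f q"
proof -
  note gK = GDERIV_grad_q[OF K_C1] and gW = GDERIV_grad_q[OF W_C1]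
  define g where "g p = grad_q K p - grad_q W p" for p
  define c where "c = b1bar / 2 - M"
  have W_pos: "0 < W (t, q)" if "q \<noteq> 0" for t q
    using C5(2)[OF that, of t] C5(1) by (auto simp: zero_less_mult_iff)
  have W_super: "2 * W (t, q) \<le> q \<bullet> grad_q W (t, q)" if "q \<noteq> 0" for t q
  proof -
    have "2 * W (t, q) \<le> \<mu> * W (t, q)"
      using C5(1) W_pos[OF that, of t] by (intro mult_right_mono) auto
    then show ?thesis using C5(2)[OF that, of t] by linarith
  qed
  obtain CK where CK: "\<And>t q. norm q \<le> 1 \<Longrightarrow> norm (grad_q K (t, q)) \<le> CK"
    using C1(1) unfolding unif_bounded_in_time_def by (metis zero_less_one)
  obtain CW where CW: "\<And>t q. norm q \<le> 1 \<Longrightarrow> norm (grad_q W (t, q)) \<le> CW"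
    using C1(2) unfolding unif_bounded_in_time_def by (metis zero_less_one)
  note W_sphere = superquadratic_le_sup_on_sphere[where w = "\<lambda>t x. W (t, x)",
      OF gW W_super W_pos CW, folded M_def]
  have M: "W (t, q) \<le> M * (norm q)\<^sup>2" if "norm q \<le> 1" for t q
    using W_sphere(1) that by blast
  have "M \<ge> 0" using W_sphere(2)[of 0] by simp
  have W0: "W (t, 0) = 0" for t
    using superquadratic_at_0[OF gW W_super W_pos] .
  have K0: "K (t, 0) = 0" for t using C2(3)[of 0 t] by simp
  \<comment> \<open>\<open>b1bar \<le> 2 b1\<close> gives the bound on the potential; \<open>b1bar \<le> 1\<close> makes \<open>c \<le> 1/2\<close>, the weight of the kinetic term.\<close>
  have coercive: "c * (norm q)\<^sup>2 \<le> K (t, q) - W (t, q)" if "norm q \<le> 1" for t q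
  proof -
    have "c * (norm q)\<^sup>2 \<le> (b1 - M) * (norm q)\<^sup>2"
      by (intro mult_right_mono) (auto simp: c_def b1bar_def)
    then show ?thesis using M[OF that, of t] C2(3)[of q t] by (simp add: left_diff_distrib)
  qed
  have f_bound: "sqrt 2 / 4 * (b1bar - 2 * M) = c / sqrt 2"
    by (simp add: c_def field_simps)
  note f_small' = f_small[unfolded f_bound]
  have gU: "GDERIV (\<lambda>x. K (t, x) - W (t, x)) x :> g (t, x)" for t x
    unfolding g_def by (intro GDERIV_diff gK gW)
  have U0: "K (t, 0) - W (t, 0) = 0" for t by (simp add: W0 K0)
  have c: "0 < c" "c \<le> 1 / 2" using M_less \<open>M \<ge> 0\<close> by (auto simp: c_def b1bar_def)
  have g_cont: "continuous_on UNIV g"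
    unfolding g_def by (intro continuous_intros continuous_grad_q K_C1 W_C1)
  have g_bound: "norm (g (t, x)) \<le> CK + CW" if "norm x \<le> 1" for t x
    unfolding g_def using that
    by (intro order_trans[OF norm_triangle_ineq4] add_mono CK CW)
  obtain Q D where Q: "\<And>t. (Q has_vector_derivative D t) (at t)"
    and D: "\<And>t. (D has_vector_derivative g (t, Q t) + f t) (at t)"
    and lim: "(Q \<longlongrightarrow> 0) at_top" "(Q \<longlongrightarrow> 0) at_bot" "(D \<longlongrightarrow> 0) at_top" "(D \<longlongrightarrow> 0) at_bot"
    using homoclinic_of_small_forcing[where U = "\<lambda>p. K p - W p", OF gU U0 coercive g_cont g_bound c
        f_cont f_bounded f_L2 f_small'] by blast
  have Q_cont: "continuous_on UNIV Q"
    using Q by (intro continuous_at_imp_continuous_on ballI has_vector_derivative_continuous)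
  have "GDERIV (\<lambda>x. V (t, x)) q :> - g (t, q)" for t q
  proof -
    have "(\<lambda>x. V (t, x)) = (\<lambda>x. - (K (t, x) - W (t, x)))" by (simp add: V)
    then show ?thesis using GDERIV_minus[OF gU] by simp
  qed
  then have gV: "grad_q V (t, q) = - g (t, q)" for t q by (rule grad_q_eqI)
  have "continuous_on UNIV (\<lambda>t. g (t, Q t) + f t)"
    by (intro continuous_intros continuous_on_compose2[OF g_cont] Q_cont f_cont) auto
  then have "solution V f Q"
    unfolding solution_def using Q D lim
    by (intro exI[of _ D] exI[of _ "\<lambda>t. g (t, Q t) + f t"]) (simp add: gV)
  then show ?thesis by blast
qed

end
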